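(* Let $n \geqslant 3$ be an integer, and let $R$ be an integral domain that is either infinite, or finite (hence a field) of size $|R| > 2^{n-1}$. Let $M = R^n$ with basis $e_1, \dots, e_n$, and set $N := \binom{n}{\lceil n/2 \rceil}$. Then: (i) There exist $N$ directions (vectors) $\mathbf{v}_1, \dots, \mathbf{v}_N \in R^n$ such that for any map $f : R^n \to R$, if the restrictions of $f$ to the lines \[ m_0 + R e_i \ \ (\text{for all } m_0 \in R^n,\ 1 \leqslant i \leqslant n), \qquad \text{and} \qquad R \mathbf{v}_1, \dots, R \mathbf{v}_N \] are each affine-linear, then $f$ is affine-linear on $R^n$. (ii) Fewer than $N$ directions do not suffice: for any integer $0 \leqslant N' < N$ and any vectors $\mathbf{v}_1, \dots, \mathbf{v}_{N'} \in R^n$, there exists a map $f : R^n \to R$ that is not affine-linear on $R^n$, but whose restrictions to all lines $m_0 + R e_i$ ($m_0 \in R^n$, $1 \leqslant i \leqslant n$) and to the lines $R\mathbf{v}_1, \dots, R\mathbf{v}_{N'}$ are each affine-linear.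
   Context: Let $R$ be a unital commutative ring, $N_0 \leqslant M$ two $R$-modules, and $m_0 \in M$. An $R$-valued function $f$ on the affine submodule $\ell := m_0 + N_0 \subseteq M$ is called affine-linear if for all $m_1 \in \ell$, the map $f_{m_1} : N_0 \to R$, $x \mapsto f(x + m_1) - f(m_1)$, is $R$-linear. (The case $N_0 = Re$ gives affine-linearity along the line $m_0 + Re$; the case $N_0 = M$ gives affine-linearity on $M$.) For $e \in M$, $Re = \{re : r \in R\}$. *)

theory Defs
  imports "HOL-Analysis.Analysis"
begin

text \<open>
  A map out of a submodule \<open>N0\<close> of \<open>M\<close>, or out of a coset \<open>m0 + N0\<close>, is represented by a
  total function on \<open>M\<close>; the definitions below only look at its values on \<open>N0\<close>,
  respectively on \<open>m0 + N0\<close>. The scalar action is an explicit parameter because the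
  library interprets the module locales for vectors over a field only. Both definitions are
  meant for a \<open>smul\<close> satisfying \<^locale>\<open>module\<close> and an \<open>N0\<close> that is a submodule
  (\<^const>\<open>module.subspace\<close>).
\<close>

definition linear_form_on ::
    "('r::comm_ring_1 \<Rightarrow> 'm::ab_group_add \<Rightarrow> 'm) \<Rightarrow> 'm set \<Rightarrow> ('m \<Rightarrow> 'r) \<Rightarrow> bool" where
  "linear_form_on smul N0 g \<longleftrightarrow>
     (\<forall>x\<in>N0. \<forall>y\<in>N0. g (x + y) = g x + g y) \<and>
     (\<forall>r. \<forall>x\<in>N0. g (smul r x) = r * g x)"

definition affine_linear_on ::
    "('r::comm_ring_1 \<Rightarrow> 'm::ab_group_add \<Rightarrow> 'm) \<Rightarrow> 'm \<Rightarrow> 'm set \<Rightarrow> ('m \<Rightarrow> 'r) \<Rightarrow> bool" where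
  "affine_linear_on smul m0 N0 f \<longleftrightarrow>
     (\<forall>m1 \<in> (+) m0 ` N0. linear_form_on smul N0 (\<lambda>x. f (x + m1) - f m1))"

definition cyclic_submodule :: "('r::comm_ring_1 \<Rightarrow> 'm::ab_group_add \<Rightarrow> 'm) \<Rightarrow> 'm \<Rightarrow> 'm set" where
  "cyclic_submodule smul e = range (\<lambda>r. smul r e)"

lemma linear_form_on_UNIV_iff_module_hom:
  assumes "module smul"
  shows "linear_form_on smul UNIV g \<longleftrightarrow> module_hom smul (*) g"
proof -
  have "module ((*) :: 'a \<Rightarrow> 'a \<Rightarrow> 'a)"
    by unfold_locales (simp_all add: algebra_simps)
  with assms show ?thesis
    by (auto simp: linear_form_on_def module_hom_iff)
qed

lemma module_vec: "module ((*s) :: 'a::comm_ring_1 \<Rightarrow> 'a ^ 'n \<Rightarrow> 'a ^ 'n)"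
  by unfold_locales (simp_all add: vec_eq_iff algebra_simps)

lemma cyclic_submodule_eq_span:
  assumes "module smul"
  shows "cyclic_submodule smul e = module.span smul {e}"
  by (simp add: cyclic_submodule_def module.span_singleton[OF assms])

text \<open>
  All coordinate lines \<open>m0 + R e\<^sub>i\<close>, where \<open>e\<^sub>i\<close> is the standard basis vector
  \<^term>\<open>axis i 1\<close>.
\<close>

definition affine_linear_on_coordinate_lines :: "('a::comm_ring_1 ^ 'n \<Rightarrow> 'a) \<Rightarrow> bool" where
  "affine_linear_on_coordinate_lines f \<longleftrightarrow>
     (\<forall>m0 i. affine_linear_on (*s) m0 (cyclic_submodule (*s) (axis i 1)) f)"

end

theory Submission
  imports Defs "HOL-Algebra.Multiplicative_Group" "HOL-Library.Nat_Bijection"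
begin

text \<open>
  A map that is affine-linear on all coordinate lines is a multi-affine polynomial
  \<open>\<Sum>\<^sub>S c\<^sub>S x\<^sup>S\<close>, and since \<open>|R| > n\<close> it is affine-linear on \<open>R v\<close> iff each
  homogeneous component of degree at least 2 vanishes at \<open>v\<close>. In degree \<open>\<lceil>n/2\<rceil>\<close> this is one
  linear equation per direction in \<open>N\<close> unknown coefficients, so fewer than \<open>N\<close> directions leave
  a nonzero solution. Conversely, take \<open>v\<^sub>j = (1, \<omega>^j, \<omega>^(2j), \<omega>^(4j), \<dots>)\<close> for \<open>0 \<le> j < N\<close>, where
  the first \<open>2\<^sup>n\<^sup>-\<^sup>1\<close> powers of \<open>\<omega>\<close> are distinct: the equations in each fixed degree then form a
  Vandermonde system with distinct nodes and at most \<open>N\<close> unknowns.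
\<close>

section \<open>Multi-affine maps\<close>

lemma axis_add: "axis i (s + t) = (axis i s + axis i t :: 'a::comm_ring_1 ^ 'n)"
  by (simp add: axis_def vec_eq_iff)

lemma scale_axis: "s *s axis i t = (axis i (s * t) :: 'a::comm_ring_1 ^ 'n)"
  by (simp add: axis_def vec_eq_iff)

text \<open>A coordinate line is spanned by one vector, so compatibility with scalars already forces
  additivity. Since \<open>x\<close> ranges over all points, every base point \<open>m1\<close> of
  every line is covered.\<close>

lemma affine_linear_on_coordinate_lines_iff:
  fixes f :: "'a::comm_ring_1 ^ 'n \<Rightarrow> 'a"
  shows "affine_linear_on_coordinate_lines f \<longleftrightarrow>
    (\<forall>x i t. f (x + axis i t) = f x + t * (f (x + axis i 1) - f x))"
proof
  assume f: "affine_linear_on_coordinate_lines f"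
  show "\<forall>x i t. f (x + axis i t) = f x + t * (f (x + axis i 1) - f x)"
  proof (intro allI)
    fix x :: "'a ^ 'n" and i t
    have "x \<in> (+) x ` range (\<lambda>r. r *s axis i 1)"
      by (metis add_0_right image_eqI rangeI vector_smult_lzero)
    with f have "linear_form_on (*s) (range (\<lambda>r. r *s axis i 1)) (\<lambda>y. f (y + x) - f x)"
      unfolding affine_linear_on_coordinate_lines_def affine_linear_on_def cyclic_submodule_def
      by blast
    moreover have "axis i 1 \<in> range (\<lambda>r. r *s (axis i 1 :: 'a ^ 'n))"
      by (metis rangeI vector_smult_lid)
    ultimately have "f (t *s axis i 1 + x) - f x = t * (f (axis i 1 + x) - f x)"
      unfolding linear_form_on_def by blast
    then show "f (x + axis i t) = f x + t * (f (x + axis i 1) - f x)"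
      by (simp add: scale_axis add.commute algebra_simps)
  qed
next
  assume f: "\<forall>x i t. f (x + axis i t) = f x + t * (f (x + axis i 1) - f x)"
  define d where "d i x = f (x + axis i 1) - f x" for i x
  have *: "f (axis i t + x) - f x = t * d i x" for x i t
    using f[rule_format, of x i t] by (simp add: add.commute d_def)
  have "linear_form_on (*s) (range (\<lambda>r. r *s axis i 1)) (\<lambda>y. f (y + m) - f m)" for i m
    unfolding linear_form_on_def
    by (safe; simp only: scale_axis axis_add[symmetric] * mult_1_right distrib_right mult.assoc)
  then show "affine_linear_on_coordinate_lines f"
    unfolding affine_linear_on_coordinate_lines_def affine_linear_on_def cyclic_submodule_def
    by blast
qed

text \<open>A product over a set contains each variable at most once, so it has degree at most 1 in
  each coordinate. The family \<open>P\<close> is arbitrary so that homogeneous pieces are covered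
  too.\<close>

lemma affine_linear_on_coordinate_lines_monomial_sum:
  fixes c :: "'n::finite set \<Rightarrow> 'a::comm_ring_1"
  shows "affine_linear_on_coordinate_lines (\<lambda>x. \<Sum>S\<in>P. c S * (\<Prod>i\<in>S. x $ i))"
proof -
  have monomial: "(\<Prod>j\<in>S. (x + axis i t) $ j) =
      (\<Prod>j\<in>S. x $ j) + t * ((\<Prod>j\<in>S. (x + axis i 1) $ j) - (\<Prod>j\<in>S. x $ j))"
    for S i t and x :: "'a ^ 'n"
  proof -
    have rest: "(\<Prod>j\<in>S - {i}. (x + axis i s) $ j) = (\<Prod>j\<in>S - {i}. x $ j)" for s
      by (rule prod.cong) (auto simp: axis_def)
    show ?thesis
    proof (cases "i \<in> S")
      case True
      then have "(\<Prod>j\<in>S. y $ j) = y $ i * (\<Prod>j\<in>S - {i}. y $ j)" for y :: "'a ^ 'n"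
        by (simp add: prod.remove)
      then show ?thesis
        by (simp only: rest) (simp add: axis_def algebra_simps)
    next
      case False
      then show ?thesis
        using rest by simp
    qed
  qed
  show ?thesis
    unfolding affine_linear_on_coordinate_lines_iff sum_subtractf[symmetric] sum_distrib_left
      sum.distrib[symmetric]
  proof (intro allI sum.cong refl)
    fix x :: "'a ^ 'n" and i t S
    show "c S * (\<Prod>j\<in>S. (x + axis i t) $ j) = c S * (\<Prod>j\<in>S. x $ j) +
        t * (c S * (\<Prod>j\<in>S. (x + axis i 1) $ j) - c S * (\<Prod>j\<in>S. x $ j))"
      unfolding monomial[where x = x and i = i and t = t and S = S]
      by (simp only: algebra_simps)
  qed
qed

lemma coordinate_affine_imp_monomial_sum:
  fixes f :: "'a::comm_ring_1 ^ 'n::finite \<Rightarrow> 'a"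
  assumes "affine_linear_on_coordinate_lines f"
  obtains c where "\<And>x. f x = (\<Sum>S\<in>UNIV. c S * (\<Prod>i\<in>S. x $ i))"
proof -
  \<comment> \<open>Restricting to points supported in \<open>A\<close> allows induction on
    \<open>A\<close>, one variable at a time. The map is generalised because the induction
    hypothesis is applied both to \<open>f\<close> and to its slope in the new direction.\<close>
  have "\<exists>c. \<forall>x. (\<forall>i. i \<notin> A \<longrightarrow> x $ i = 0) \<longrightarrow> f x = (\<Sum>S\<in>Pow A. c S * (\<Prod>i\<in>S. x $ i))"
    if "affine_linear_on_coordinate_lines f" for f :: "'a ^ 'n \<Rightarrow> 'a" and A
    using finite[of A] that
  proof (induction A arbitrary: f)
    case empty
    show ?case
    proof (intro exI allI impI)
      fix x :: "'a ^ 'n"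
      assume "\<forall>i. i \<notin> {} \<longrightarrow> x $ i = 0"
      then have "x = 0"
        by (simp add: vec_eq_iff)
      then show "f x = (\<Sum>S\<in>Pow {}. f 0 * (\<Prod>i\<in>S. x $ i))"
        by simp
    qed
  next
    case (insert a A)
    define g where "g x = f (x + axis a 1) - f x" for x
    have f: "f (x + axis i t) = f x + t * (f (x + axis i 1) - f x)" for x i t
      using insert.prems unfolding affine_linear_on_coordinate_lines_iff by blast
    have "affine_linear_on_coordinate_lines g"
      unfolding affine_linear_on_coordinate_lines_iff
    proof (intro allI)
      fix x :: "'a ^ 'n" and i t
      have swap: "x + axis i s + axis a 1 = (x + axis a 1) + axis i s" for s
        by (simp only: ac_simps)
      show "g (x + axis i t) = g x + t * (g (x + axis i 1) - g x)"
        unfolding g_def swap f[of x i t] f[of "x + axis a 1" i t] by (simp only: algebra_simps)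
    qed
    from insert.IH[OF this] obtain d
      where d: "\<And>x. (\<forall>i. i \<notin> A \<longrightarrow> x $ i = 0) \<Longrightarrow> g x = (\<Sum>S\<in>Pow A. d S * (\<Prod>i\<in>S. x $ i))"
      by blast
    from insert.IH[OF insert.prems] obtain c
      where c: "\<And>x. (\<forall>i. i \<notin> A \<longrightarrow> x $ i = 0) \<Longrightarrow> f x = (\<Sum>S\<in>Pow A. c S * (\<Prod>i\<in>S. x $ i))"
      by blast
    \<comment> \<open>Sets without \<open>a\<close> take their coefficient from \<open>f\<close> at
      \<open>x $ a = 0\<close>, sets containing \<open>a\<close> from the slope
      \<open>g\<close>.\<close>
    define b where "b S = (if a \<in> S then d (S - {a}) else c S)" for S
    have "f x = (\<Sum>S\<in>Pow (insert a A). b S * (\<Prod>i\<in>S. x $ i))"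
      if x: "\<forall>i. i \<notin> insert a A \<longrightarrow> x $ i = 0" for x
    proof -
      define y where "y = (\<chi> i. if i = a then 0 else x $ i)"
      have y: "\<forall>i. i \<notin> A \<longrightarrow> y $ i = 0"
        using x by (simp add: y_def)
      have prod_y: "(\<Prod>i\<in>S. y $ i) = (\<Prod>i\<in>S. x $ i)" if "S \<subseteq> A" for S
        using that insert.hyps by (intro prod.cong) (auto simp: y_def)
      have split: "y + axis a (x $ a) = x"
        by (simp add: y_def axis_def vec_eq_iff)
      have "f x = f y + x $ a * g y"
        using f[of y a "x $ a"] unfolding split g_def .
      also have "f y = (\<Sum>S\<in>Pow A. b S * (\<Prod>i\<in>S. x $ i))"
        unfolding c[OF y] using insert.hyps
        by (intro sum.cong) (auto simp: b_def prod_y)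
      also have "x $ a * g y = (\<Sum>S\<in>insert a ` Pow A. b S * (\<Prod>i\<in>S. x $ i))"
      proof -
        have inj: "inj_on (insert a) (Pow A)"
          using insert.hyps by (auto simp: inj_on_def)
        have "b (insert a S) * (\<Prod>i\<in>insert a S. x $ i) = x $ a * (d S * (\<Prod>i\<in>S. y $ i))"
          if "S \<subseteq> A" for S
        proof -
          have "a \<notin> S"
            using that insert.hyps by blast
          then show ?thesis
            using prod_y[OF that] by (simp add: b_def algebra_simps)
        qed
        then show ?thesis
          unfolding d[OF y] sum.reindex[OF inj] sum_distrib_left
          by (intro sum.cong) auto
      qed
      also have "(\<Sum>S\<in>Pow A. b S * (\<Prod>i\<in>S. x $ i)) + (\<Sum>S\<in>insert a ` Pow A. b S * (\<Prod>i\<in>S. x $ i)) =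
          (\<Sum>S\<in>Pow (insert a A). b S * (\<Prod>i\<in>S. x $ i))"
        unfolding Pow_insert using insert.hyps
        by (intro sum.union_disjoint[symmetric]) auto
      finally show ?thesis .
    qed
    then show ?case
      by blast
  qed
  from this[OF assms, of UNIV] show thesis
    using that by auto
qed

section \<open>Polynomials along a line through the origin\<close>

lemma poly_eq_0_if_vanishing:
  fixes p :: "'a::idom poly"
  assumes "infinite (UNIV :: 'a set) \<or> CARD('a) > degree p" and "\<And>t. poly p t = 0"
  shows "p = 0"
proof (rule ccontr)
  assume "p \<noteq> 0"
  then have "finite {t. poly p t = 0}" "card {t. poly p t = 0} \<le> degree p"
    by (simp_all add: poly_roots_finite card_poly_roots_bound)
  then show False
    using assms by auto
qed

text \<open>Along \<open>t *s v\<close> the map is a polynomial in \<open>t\<close> whose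
  coefficient at \<open>t ^ k\<close> is the sum in question. It agrees with a polynomial of degree
  at most 1 at every \<open>t\<close>, and \<open>R\<close> has more elements than the degree, so
  the two polynomials coincide.\<close>

lemma homogeneous_component_eq_0:
  fixes c :: "'n::finite set \<Rightarrow> 'a::idom" and v :: "'a ^ 'n"
  assumes "affine_linear_on (*s) 0 (cyclic_submodule (*s) v) (\<lambda>x. \<Sum>S\<in>UNIV. c S * (\<Prod>i\<in>S. x $ i))"
    (is "affine_linear_on _ _ _ ?f")
    and "infinite (UNIV :: 'a set) \<or> CARD('a) > CARD('n)" and "k \<ge> 2"
  shows "(\<Sum>S | card S = k. c S * (\<Prod>i\<in>S. v $ i)) = 0"
proof -
  have "0 \<in> (+) 0 ` range (\<lambda>r. r *s v)"
    by (metis add_0_right image_eqI rangeI vector_smult_lzero)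
  with assms(1) have "linear_form_on (*s) (range (\<lambda>r. r *s v)) (\<lambda>y. ?f (y + 0) - ?f 0)"
    unfolding affine_linear_on_def cyclic_submodule_def by blast
  moreover have "v \<in> range (\<lambda>r. r *s v)"
    by (metis rangeI vector_smult_lid)
  ultimately have line: "?f (t *s v) - ?f 0 = t * (?f v - ?f 0)" for t
    unfolding linear_form_on_def by (simp only: add_0_right)
  define q where "q = (\<Sum>S\<in>UNIV. Polynomial.monom (c S * (\<Prod>i\<in>S. v $ i)) (card S))"
  define p where "p = q - [:?f 0, ?f v - ?f 0:]"
  have "poly q t = ?f (t *s v)" for t
    by (simp add: q_def poly_sum poly_monom prod.distrib algebra_simps)
  with line have "poly p t = 0" for t
    by (simp add: p_def algebra_simps)
  moreover have "degree p \<le> CARD('n)"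
  proof -
    have "degree q \<le> CARD('n)"
      unfolding q_def
      by (intro degree_sum_le order.trans[OF degree_monom_le] card_mono) auto
    moreover have "degree [:?f 0, ?f v - ?f 0:] \<le> CARD('n)"
      by (rule order.trans[of _ 1]) (auto simp: Suc_le_eq)
    ultimately show ?thesis
      unfolding p_def by (rule degree_diff_le)
  qed
  ultimately have "p = 0"
    using assms(2) by (intro poly_eq_0_if_vanishing) auto
  then have "0 = Polynomial.coeff p k"
    by simp
  also have "\<dots> = Polynomial.coeff q k"
    using \<open>k \<ge> 2\<close> by (cases k rule: nat.exhaust; cases "k - 1") (auto simp: p_def)
  also have "\<dots> = (\<Sum>S\<in>UNIV. if card S = k then c S * (\<Prod>i\<in>S. v $ i) else 0)"
    by (simp add: q_def coeff_sum)
  also have "\<dots> = (\<Sum>S | card S = k. c S * (\<Prod>i\<in>S. v $ i))"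
    by (simp add: sum.inter_filter[symmetric])
  finally show ?thesis
    by simp
qed

section \<open>Linear systems over an integral domain\<close>

text \<open>Gaussian elimination without division, by induction on the set of equations.\<close>

lemma homogeneous_system_nontrivial_solution:
  fixes a :: "'j \<Rightarrow> 'i \<Rightarrow> 'a::idom"
  assumes "finite J" "finite I" "card J < card I"
  shows "\<exists>c. (\<exists>i\<in>I. c i \<noteq> 0) \<and> (\<forall>j\<in>J. (\<Sum>i\<in>I. a j i * c i) = 0)"
  using assms
proof (induction J arbitrary: I a rule: finite_induct)
  case empty
  then show ?case
    by (intro exI[of _ "\<lambda>_. 1"]) (auto simp: card_gt_0_iff)
next
  case (insert j J)
  show ?case
  proof (cases "\<forall>i\<in>I. a j i = 0")
    case True
    obtain c where "\<exists>i\<in>I. c i \<noteq> 0" "\<forall>j\<in>J. (\<Sum>i\<in>I. a j i * c i) = 0"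
      using insert.IH[of I a] insert.prems insert.hyps by auto
    with True show ?thesis
      by (intro exI[of _ c]) auto
  next
    case False
    then obtain p where p: "p \<in> I" "a j p \<noteq> 0"
      by blast
    \<comment> \<open>Cross-multiplying with the pivot row \<open>j\<close> cancels the unknown
      \<open>p\<close> from row \<open>j'\<close>.\<close>
    define b where "b j' i = a j p * a j' i - a j' p * a j i" for j' i
    have "card J < card (I - {p})"
      using insert.prems insert.hyps p by simp
    then obtain d where d: "\<exists>i\<in>I - {p}. d i \<noteq> 0" "\<forall>j'\<in>J. (\<Sum>i\<in>I - {p}. b j' i * d i) = 0"
      using insert.IH[of "I - {p}" b] insert.prems by auto
    \<comment> \<open>Back substitution: scaling the other unknowns by the pivot makes row
      \<open>j\<close> solvable for \<open>c p\<close> inside \<open>R\<close>. The solution stays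
      nonzero because \<open>R\<close> is a domain.\<close>
    define c where "c i = (if i = p then - (\<Sum>i\<in>I - {p}. a j i * d i) else a j p * d i)" for i
    have row: "(\<Sum>i\<in>I. a j' i * c i) = (\<Sum>i\<in>I - {p}. b j' i * d i)" for j'
    proof -
      have "(\<Sum>i\<in>I. a j' i * c i) = a j' p * c p + (\<Sum>i\<in>I - {p}. a j' i * c i)"
        using p insert.prems by (simp add: sum.remove)
      also have "(\<Sum>i\<in>I - {p}. a j' i * c i) = (\<Sum>i\<in>I - {p}. a j' i * (a j p * d i))"
        by (intro sum.cong) (auto simp: c_def)
      finally show ?thesis
        by (simp add: c_def b_def sum_subtractf sum_distrib_left algebra_simps)
    qed
    have "(\<Sum>i\<in>I. a j i * c i) = 0"
      unfolding row by (simp add: b_def)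
    moreover have "\<exists>i\<in>I. c i \<noteq> 0"
      using d(1) p by (auto simp: c_def)
    ultimately show ?thesis
      using d(2) row by (intro exI[of _ c]) auto
  qed
qed

text \<open>Combine the equations with the coefficients of a polynomial that vanishes at all nodes
  except \<open>x s\<close>; only the term of \<open>s\<close> survives. Its degree is
  \<open>card A - 1 < N\<close>, so enough equations are at hand.\<close>

lemma vandermonde_system_trivial:
  fixes c x :: "'s \<Rightarrow> 'a::idom"
  assumes "finite A" "inj_on x A" "card A \<le> N"
    and eq: "\<And>j. j < N \<Longrightarrow> (\<Sum>s\<in>A. c s * x s ^ j) = 0"
    and "s \<in> A"
  shows "c s = 0"
proof -
  define p where "p = (\<Prod>t\<in>A - {s}. [:- x t, 1:])"
  have "degree p = card (A - {s})"
    unfolding p_def by (subst degree_prod_eq_sum_degree) auto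
  also have "\<dots> < N"
    using assms by (metis card_Diff1_less order_less_le_trans)
  finally have "degree p < N" .
  have "(\<Sum>t\<in>A. c t * poly p (x t)) = (\<Sum>j\<le>degree p. Polynomial.coeff p j * (\<Sum>t\<in>A. c t * x t ^ j))"
    unfolding poly_altdef sum_distrib_left
    by (subst sum.swap) (simp add: algebra_simps)
  also have "\<dots> = 0"
    using eq \<open>degree p < N\<close> by (intro sum.neutral) auto
  also have "(\<Sum>t\<in>A. c t * poly p (x t)) = c s * poly p (x s)"
  proof -
    have "poly p (x t) = 0" if "t \<in> A - {s}" for t
      unfolding p_def poly_prod using that \<open>finite A\<close> by (intro prod_zero) auto
    then show ?thesis
      using \<open>finite A\<close> \<open>s \<in> A\<close> by (subst sum.remove[of _ s]) auto
  qed
  finally have "c s * poly p (x s) = 0" .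
  moreover have "poly p (x s) \<noteq> 0"
    using \<open>inj_on x A\<close> \<open>s \<in> A\<close> \<open>finite A\<close> by (auto simp: p_def poly_prod inj_on_def)
  ultimately show ?thesis
    by simp
qed

section \<open>Exponents and elements of large multiplicative order\<close>

text \<open>
  Giving \<open>0\<close> the weight \<open>2 ^ 0 div 2 = 0\<close> keeps the total weight below \<open>2 ^ (n - 1)\<close>; the price
  is that only sets of equal cardinality are separated.
\<close>

lemma sum_pow2_div2_eq:
  fixes A :: "nat set"
  assumes A: "finite A"
  shows "2 * (\<Sum>i\<in>A. 2 ^ i div 2) = set_encode (A - {0})"
proof -
  have "2 * (2 ^ i div 2) = (if i = 0 then 0 else 2 ^ i :: nat)" for i :: nat
    by (cases i) auto
  then have "2 * (\<Sum>i\<in>A. 2 ^ i div 2) = (\<Sum>i\<in>A. if i = 0 then 0 else 2 ^ i :: nat)"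
    by (simp only: sum_distrib_left)
  also have "\<dots> = (\<Sum>i\<in>A - {0}. 2 ^ i)"
    using A by (intro sum.mono_neutral_cong_right) auto
  finally show ?thesis
    by (simp add: set_encode_def)
qed

text \<open>Doubling turns the sum into the binary encoding of the set without \<open>0\<close>,
  which determines that part; equal cardinality then decides whether \<open>0\<close>
  belongs.\<close>

lemma sum_pow2_div2_inj:
  fixes A B :: "nat set"
  assumes "finite A" "finite B" "card A = card B"
    and "(\<Sum>i\<in>A. 2 ^ i div 2 :: nat) = (\<Sum>i\<in>B. 2 ^ i div 2)"
  shows "A = B"
proof -
  have "set_encode (A - {0}) = set_encode (B - {0})"
    using assms sum_pow2_div2_eq[of A] sum_pow2_div2_eq[of B] by simp
  then have *: "A - {0} = B - {0}"
    using assms by (simp add: set_encode_eq)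
  then have "0 \<in> A \<longleftrightarrow> 0 \<in> B"
    using assms by (metis Diff_empty Diff_insert0 card_Diff1_less less_irrefl)
  with * show ?thesis
    by blast
qed

lemma sum_pow2_div2_less:
  fixes A :: "nat set"
  assumes "A \<subseteq> {..<n}" "n > 0"
  shows "(\<Sum>i\<in>A. 2 ^ i div 2 :: nat) < 2 ^ (n - 1)"
proof -
  have "finite A"
    using assms finite_subset by blast
  then have "2 * (\<Sum>i\<in>A. 2 ^ i div 2 :: nat) = (\<Sum>i\<in>A - {0}. 2 ^ i)"
    by (simp add: sum_pow2_div2_eq set_encode_def)
  also have "\<dots> \<le> (\<Sum>i<n. 2 ^ i)"
    using assms by (intro sum_mono2) auto
  also have "\<dots> = 2 ^ n - 1"
    by (simp add: lessThan_atLeast0 sum_power2)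
  also have "\<dots> < 2 * 2 ^ (n - 1)"
    using assms(2) by (simp flip: power_Suc)
  finally show ?thesis
    by simp
qed

text \<open>In a finite domain multiplication by a nonzero element is injective, hence surjective,
  so the domain is a field and its multiplicative group is cyclic.\<close>

lemma finite_idom_generator:
  assumes "finite (UNIV :: 'a::idom set)"
  obtains g :: "'a::idom" where "UNIV - {0} = range (\<lambda>i::nat. g ^ i)"
proof -
  \<comment> \<open>The type is repackaged as a ring with explicit carrier, the form in which the
    cyclicity theorem \<open>finite_field_mult_group_has_gen\<close> is stated.\<close>
  define R :: "'a ring" where "R = \<lparr>carrier = UNIV :: 'a set, monoid.mult = (*), one = 1, zero = 0, add = (+)\<rparr>"
  have inverse: "\<exists>y. y * x = 1" if "x \<noteq> 0" for x :: 'a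
  proof -
    have "inj (\<lambda>y. y * x)"
      using that by (auto simp: inj_on_def)
    then have "surj (\<lambda>y. y * x)"
      using assms by (simp add: finite_UNIV_inj_surj)
    then show ?thesis
      by (metis surjD)
  qed
  have "cring R"
  proof (intro cringI abelian_groupI comm_monoidI)
    show "\<exists>y\<in>carrier R. y \<oplus>\<^bsub>R\<^esub> x = \<zero>\<^bsub>R\<^esub>" for x
      by (auto simp: R_def intro: exI[of _ "- x"])
  qed (auto simp: R_def algebra_simps)
  then interpret cring R .
  have ops: "x \<otimes>\<^bsub>R\<^esub> y = x * y" "\<one>\<^bsub>R\<^esub> = 1" "\<zero>\<^bsub>R\<^esub> = 0" "carrier R = UNIV" for x y
    by (simp_all add: R_def)
  have "x \<in> Group.Units R \<longleftrightarrow> x \<noteq> 0" for x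
    using inverse[of x] by (auto simp: Units_def ops mult.commute)
  then have "Group.Units R = carrier R - {\<zero>\<^bsub>R\<^esub>}"
    by (auto simp: ops)
  then interpret field R
    by (rule cring_fieldI)
  have pow: "x [^]\<^bsub>R\<^esub> i = x ^ i" for x and i :: nat
    by (induction i) (simp_all add: ops mult.commute)
  obtain g where "carrier (mult_of R) = {g [^]\<^bsub>R\<^esub> i | i :: nat. i \<in> UNIV}"
    using finite_field_mult_group_has_gen assms by (auto simp only: ops)
  then have "UNIV - {0} = range (\<lambda>i::nat. g ^ i)"
    by (simp add: ops pow full_SetCompr_eq)
  then show thesis
    by (rule that)
qed

text \<open>It suffices that \<open>w\<close> is nonzero and not a root of unity of any order below
  \<open>m\<close>.\<close>

lemma exists_powers_inj_on:
  assumes "infinite (UNIV :: 'a::idom set) \<or> CARD('a) > m"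
  obtains w :: "'a::idom" where "inj_on (\<lambda>j. w ^ j) {..<m}"
proof -
  obtain w :: 'a where w: "w \<noteq> 0" "\<And>j. 0 < j \<Longrightarrow> j < m \<Longrightarrow> w ^ j \<noteq> 1"
  proof (cases "finite (UNIV :: 'a set)")
    case False
    \<comment> \<open>The bad elements are \<open>0\<close> and the roots of finitely many nonzero
      polynomials, a finite set.\<close>
    define B where "B = insert 0 (\<Union>j\<in>{0<..<m}. {x::'a. poly (Polynomial.monom 1 j - 1) x = 0})"
    have "finite {x::'a. poly (Polynomial.monom 1 j - 1) x = 0}" if "0 < j" for j
      using that by (intro poly_roots_finite) (auto simp: poly_eq_iff intro!: exI[of _ j])
    then have "finite B"
      unfolding B_def by (intro finite.insertI finite_UN_I) auto
    with False obtain w where "w \<notin> B"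
      using ex_new_if_finite by blast
    then show thesis
      using that[of w] by (auto simp: B_def poly_monom)
  next
    case True
    then obtain g :: 'a where g: "UNIV - {0} = range (\<lambda>i::nat. g ^ i)"
      by (rule finite_idom_generator)
    \<comment> \<open>If \<open>g ^ j = 1\<close>, the first \<open>j\<close> powers exhaust all
      nonzero elements, so \<open>j\<close> is at least \<open>CARD('a) - 1\<close>, hence at least
      \<open>m\<close>.\<close>
    have "m \<le> j" if "0 < j" "g ^ j = 1" for j
    proof -
      have "g ^ i \<in> (\<lambda>i. g ^ i) ` {..<j}" for i
      proof (rule image_eqI)
        have "g ^ i = g ^ (j * (i div j) + i mod j)"
          by simp
        also have "\<dots> = g ^ (i mod j)"
          by (simp only: power_add power_mult that(2) power_one mult_1)
        finally show "g ^ i = g ^ (i mod j)" .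
      qed (use that(1) in simp)
      then have "UNIV - {0} \<subseteq> (\<lambda>i. g ^ i) ` {..<j}"
        unfolding g by blast
      then have "card (UNIV - {0 :: 'a}) \<le> card {..<j}"
        by (rule surj_card_le[OF finite_lessThan])
      then show ?thesis
        using assms True by simp
    qed
    moreover have "g \<noteq> 0"
      using range_eqI[of g "\<lambda>i. g ^ i" 1] unfolding g[symmetric] by simp
    ultimately show thesis
      using that[of g] by (meson not_le)
  qed
  have "w ^ i \<noteq> w ^ j" if "i < j" "j < m" for i j
  proof
    assume "w ^ i = w ^ j"
    moreover have "w ^ i * w ^ (j - i) = w ^ j"
      using \<open>i < j\<close> by (simp flip: power_add)
    ultimately have "w ^ i * w ^ (j - i) = w ^ i * 1"
      by simp
    then have "w ^ (j - i) = 1"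
      using w(1) by (simp only: mult_cancel_left) simp
    then show False
      using w(2)[of "j - i"] that by simp
  qed
  then have "inj_on (\<lambda>j. w ^ j) {..<m}"
    by (intro linorder_inj_onI) auto
  then show thesis
    by (rule that)
qed

section \<open>The number of directions\<close>

text \<open>Stated for coefficients in one degree: there are \<open>CARD('n) choose card S\<close>
  unknowns, so the hypothesis says that the \<open>N\<close> equations are at least as many.\<close>

lemma directions_suffice:
  assumes R_size: "infinite (UNIV :: 'a::idom set) \<or> CARD('a) > 2 ^ (CARD('n::finite) - 1)"
  shows "\<exists>v :: nat \<Rightarrow> 'a ^ 'n. \<forall>c S. CARD('n) choose card S \<le> N \<longrightarrow>
    (\<forall>j<N. (\<Sum>T | card T = card S. c T * (\<Prod>i\<in>T. v j $ i)) = 0) \<longrightarrow> c S = 0"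
proof -
  let ?n = "CARD('n)"
  obtain h :: "'n \<Rightarrow> nat" where h: "bij_betw h UNIV {..<?n}"
    using ex_bij_betw_finite_nat[OF finite, of "UNIV :: 'n set"] by (auto simp: atLeast0LessThan)
  have inj_h: "inj_on h S" for S
    using h by (auto simp: bij_betw_def intro: inj_on_subset)
  obtain w :: 'a where w: "inj_on (\<lambda>j. w ^ j) {..<2 ^ (?n - 1)}"
    using exists_powers_inj_on R_size by blast
  define e where "e S = (\<Sum>i\<in>S. 2 ^ h i div 2 :: nat)" for S
  have e: "e S = (\<Sum>i\<in>h ` S. 2 ^ i div 2)" for S
    by (simp add: e_def sum.reindex[OF inj_h])
  \<comment> \<open>The size bound on \<open>R\<close> enters here: these exponents lie in the range
    on which powers of \<open>w\<close> are distinct.\<close>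
  have e_less: "e S < 2 ^ (?n - 1)" for S
    unfolding e using h by (intro sum_pow2_div2_less) (auto simp: bij_betw_def)
  have e_inj: "S = T" if "e S = e T" "card S = card T" for S T
  proof -
    have "h ` S = h ` T"
      using that by (intro sum_pow2_div2_inj) (auto simp: e card_image[OF inj_h])
    then show ?thesis
      using h by (simp add: bij_betw_def inj_image_eq_iff)
  qed
  define v :: "nat \<Rightarrow> 'a ^ 'n" where "v j = (\<chi> i. w ^ (j * (2 ^ h i div 2)))" for j
  \<comment> \<open>Each monomial at \<open>v j\<close> is the \<open>j\<close>-th power of a node
    depending only on \<open>S\<close>, which is the Vandermonde shape.\<close>
  have v: "(\<Prod>i\<in>S. v j $ i) = (w ^ e S) ^ j" for j S
    by (simp add: v_def e_def power_sum[symmetric] sum_distrib_left[symmetric] power_mult[symmetric] mult.commute)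
  have "c S = 0"
    if "?n choose card S \<le> N"
      and eq: "\<forall>j<N. (\<Sum>T | card T = card S. c T * (\<Prod>i\<in>T. v j $ i)) = 0"
    for c :: "'n set \<Rightarrow> 'a" and S
  proof -
    let ?A = "{T :: 'n set. card T = card S}"
    have "card ?A = ?n choose card S"
      using n_subsets[of "UNIV :: 'n set" "card S"] by simp
    moreover have "inj_on (\<lambda>T. w ^ e T) ?A"
    proof (rule inj_onI)
      fix T U
      assume "T \<in> ?A" "U \<in> ?A" "w ^ e T = w ^ e U"
      then show "T = U"
        using inj_onD[OF w, of "e T" "e U"] e_less by (intro e_inj) auto
    qed
    ultimately show ?thesis
      using eq that(1)
      by (intro vandermonde_system_trivial[of ?A "\<lambda>T. w ^ e T" N c S]) (auto simp: v)
  qed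
  then show ?thesis
    by blast
qed

text \<open>In the increment from \<open>m\<close> to \<open>x + m\<close> the constant cancels, and
  what remains is a linear form in \<open>x\<close> independent of \<open>m\<close>.\<close>

lemma affine_linear_on_UNIV_if_degree_le_1:
  fixes c :: "'n::finite set \<Rightarrow> 'a::comm_ring_1"
  assumes "\<And>S. card S \<ge> 2 \<Longrightarrow> c S = 0"
  shows "affine_linear_on (*s) 0 UNIV (\<lambda>x. \<Sum>S\<in>UNIV. c S * (\<Prod>i\<in>S. x $ i))"
proof -
  have "c S * (\<Prod>i\<in>S. (x + m) $ i) - c S * (\<Prod>i\<in>S. m $ i) =
      (if card S = 1 then c S * (\<Sum>i\<in>S. x $ i) else 0)" for S and x m :: "'a ^ 'n"
  proof (cases "card S \<ge> 2")
    case False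
    then consider "card S = 0" | "card S = 1"
      by linarith
    then show ?thesis
      by cases (auto simp: card_1_singleton_iff algebra_simps)
  qed (simp add: assms)
  then have diff: "(\<Sum>S\<in>UNIV. c S * (\<Prod>i\<in>S. (x + m) $ i)) - (\<Sum>S\<in>UNIV. c S * (\<Prod>i\<in>S. m $ i)) =
      (\<Sum>S\<in>UNIV. if card S = 1 then c S * (\<Sum>i\<in>S. x $ i) else 0)" for x m :: "'a ^ 'n"
    unfolding sum_subtractf[symmetric] by (intro sum.cong refl)
  define L where "L x = (\<Sum>S\<in>UNIV. if card S = 1 then c S * (\<Sum>i\<in>S. x $ i) else 0)" for x :: "'a ^ 'n"
  have "L (x + y) = L x + L y" for x y
    unfolding L_def sum.distrib[symmetric]
    by (intro sum.cong refl) (simp add: sum.distrib distrib_left)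
  moreover have "L (r *s x) = r * L x" for r x
    unfolding L_def sum_distrib_left
    by (intro sum.cong refl) (simp add: sum_distrib_left mult.left_commute)
  ultimately show ?thesis
    unfolding affine_linear_on_def linear_form_on_def diff L_def[symmetric] by blast
qed

text \<open>Additivity is refuted on 0-1 vectors: the indicator of \<open>T\<close> splits into
  those of \<open>T - {i}\<close> and \<open>{i}\<close>, whose supports are too small for any
  monomial of degree \<open>k \<ge> 2\<close>, while the value at the indicator of \<open>T\<close>
  is \<open>c T\<close>.\<close>

lemma homogeneous_not_affine_linear:
  fixes c :: "'n::finite set \<Rightarrow> 'a::comm_ring_1"
  assumes "k \<ge> 2" "card T = k" "c T \<noteq> 0"
  shows "\<not> affine_linear_on (*s) 0 UNIV (\<lambda>x. \<Sum>S | card S = k. c S * (\<Prod>i\<in>S. x $ i))"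
    (is "\<not> affine_linear_on _ _ _ ?f")
proof
  define F where "F = ?f"
  assume "affine_linear_on (*s) 0 UNIV ?f"
  then have "linear_form_on (*s) UNIV (\<lambda>x. F (x + 0) - F 0)"
    unfolding affine_linear_on_def F_def[symmetric] by (rule bspec) simp
  then have add: "F (x + y) - F 0 = (F x - F 0) + (F y - F 0)" for x y
    by (simp add: linear_form_on_def)
  define u :: "'n set \<Rightarrow> 'a ^ 'n" where "u A = (\<chi> i. if i \<in> A then 1 else 0)" for A
  have prod_u: "(\<Prod>i\<in>S. u A $ i) = (if S \<subseteq> A then 1 else 0)" for S A
  proof (cases "S \<subseteq> A")
    case True
    then show ?thesis
      by (auto simp: u_def intro!: prod.neutral)
  next
    case False
    then show ?thesis
      by (auto simp: u_def intro!: prod_zero)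
  qed
  have small: "F (u A) = 0" if "card A < k" for A
    unfolding F_def using that by (intro sum.neutral) (auto simp: prod_u dest: card_mono[OF finite])
  have "F (u T) = (\<Sum>S | card S = k. if S = T then c S else 0)"
    unfolding F_def using \<open>card T = k\<close>
    by (intro sum.cong) (auto simp: prod_u dest: card_subset_eq[OF finite])
  also have "\<dots> = c T"
    using \<open>card T = k\<close> by simp
  finally have fT: "F (u T) = c T" .
  obtain i where i: "i \<in> T"
    using assms by fastforce
  have "u {} = 0"
    by (simp add: u_def vec_eq_iff)
  then have "F 0 = 0"
    using small[of "{}"] assms by simp
  have "card (T - {i}) < k" "card {i} < k"
    using assms i by simp_all
  then have "F (u (T - {i})) = 0" "F (u {i}) = 0"
    by (simp_all only: small)
  moreover have "u (T - {i}) + u {i} = u T"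
    using i by (auto simp: u_def vec_eq_iff)
  ultimately show False
    using add[of "u (T - {i})" "u {i}"] fT \<open>F 0 = 0\<close> assms by simp
qed

lemma affine_linear_on_zero_line:
  fixes f :: "'a::comm_ring_1 ^ 'n \<Rightarrow> 'a"
  assumes "\<And>t. f (t *s v) = 0"
  shows "affine_linear_on (*s) 0 (cyclic_submodule (*s) v) f"
  unfolding affine_linear_on_def linear_form_on_def cyclic_submodule_def
  using assms
  by (auto simp: vector_smult_assoc simp flip: vector_sadd_rdistrib)

theorem theorem1p6:
  fixes N :: nat
  assumes n_ge_3: "CARD('n::finite) \<ge> 3"
    and R_size: "infinite (UNIV :: 'a::idom set) \<or> CARD('a) > 2 ^ (CARD('n) - 1)"
    and N_def: "N = CARD('n) choose nat \<lceil>real CARD('n) / 2\<rceil>"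
  shows
    "(\<exists>v :: nat \<Rightarrow> 'a ^ 'n.
        \<forall>f :: 'a ^ 'n \<Rightarrow> 'a.
          affine_linear_on_coordinate_lines f \<longrightarrow>
          (\<forall>k\<in>{1..N}. affine_linear_on (*s) 0 (cyclic_submodule (*s) (v k)) f) \<longrightarrow>
          affine_linear_on (*s) 0 UNIV f)
     \<and>
     (\<forall>N' < N. \<forall>v :: nat \<Rightarrow> 'a ^ 'n.
        \<exists>f :: 'a ^ 'n \<Rightarrow> 'a.
          \<not> affine_linear_on (*s) 0 UNIV f \<and>
          affine_linear_on_coordinate_lines f \<and>
          (\<forall>k\<in>{1..N'}. affine_linear_on (*s) 0 (cyclic_submodule (*s) (v k)) f))"
proof -
  let ?n = "CARD('n)"
  define k where "k = nat \<lceil>real ?n / 2\<rceil>"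
  have k: "k = (?n + 1) div 2"
    unfolding k_def by linarith
  \<comment> \<open>Rounding up or down gives the same binomial coefficient by symmetry;
    \<open>binomial_maximum\<close> is phrased with \<open>?n div 2\<close>.\<close>
  have "k = ?n div 2 \<or> ?n - k = ?n div 2" "k \<le> ?n"
    using k by linarith+
  moreover have Nk: "N = ?n choose k"
    using N_def by (simp only: k_def)
  ultimately have N: "N = ?n choose (?n div 2)"
    using binomial_symmetric[of k ?n] by metis
  have large: "infinite (UNIV :: 'a set) \<or> CARD('a) > ?n"
  proof -
    have "?n \<le> 2 ^ (?n - 1)"
      using less_exp[of "?n - 1"] by linarith
    then show ?thesis
      using R_size by auto
  qed
  obtain v :: "nat \<Rightarrow> 'a ^ 'n" where v: "\<And>c S. ?n choose card S \<le> N \<Longrightarrow>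
      (\<forall>j<N. (\<Sum>T | card T = card S. c T * (\<Prod>i\<in>T. v j $ i)) = 0) \<Longrightarrow> c S = 0"
    using directions_suffice[OF R_size, of N] by blast
  have "affine_linear_on (*s) 0 UNIV f"
    if f: "affine_linear_on_coordinate_lines f"
      \<comment> \<open>The Vandermonde directions are numbered from 0 and those of the theorem from
        1, hence the shift \<open>j - 1\<close>.\<close>
      and lines: "\<forall>j\<in>{1..N}. affine_linear_on (*s) 0 (cyclic_submodule (*s) (v (j - 1))) f"
    for f :: "'a ^ 'n \<Rightarrow> 'a"
  proof -
    obtain c where "\<And>x. f x = (\<Sum>S\<in>UNIV. c S * (\<Prod>i\<in>S. x $ i))"
      using coordinate_affine_imp_monomial_sum[OF f] by blast
    then have c: "f = (\<lambda>x. \<Sum>S\<in>UNIV. c S * (\<Prod>i\<in>S. x $ i))"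
      by blast
    have "c S = 0" if "card S \<ge> 2" for S
    proof (rule v)
      \<comment> \<open>The central binomial coefficient is the largest, so \<open>N\<close>
        directions settle every degree at once.\<close>
      show "?n choose card S \<le> N"
        by (simp add: N binomial_maximum)
      show "\<forall>j<N. (\<Sum>T | card T = card S. c T * (\<Prod>i\<in>T. v j $ i)) = 0"
      proof (intro allI impI)
        fix j
        assume "j < N"
        then have "affine_linear_on (*s) 0 (cyclic_submodule (*s) (v j)) f"
          using bspec[OF lines, of "Suc j"] by simp
        then show "(\<Sum>T | card T = card S. c T * (\<Prod>i\<in>T. v j $ i)) = 0"
          unfolding c using large that by (rule homogeneous_component_eq_0)
      qed
    qed
    then show ?thesis
      unfolding c by (rule affine_linear_on_UNIV_if_degree_le_1)
  qed
  moreover have "\<exists>f :: 'a ^ 'n \<Rightarrow> 'a.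
          \<not> affine_linear_on (*s) 0 UNIV f \<and>
          affine_linear_on_coordinate_lines f \<and>
          (\<forall>j\<in>{1..N'}. affine_linear_on (*s) 0 (cyclic_submodule (*s) (v j)) f)"
    if "N' < N" for N' and v :: "nat \<Rightarrow> 'a ^ 'n"
  proof -
    have "card {S :: 'n set. card S = k} = N"
      using n_subsets[of "UNIV :: 'n set" k] Nk by simp
    with that obtain c T where c: "card T = k" "c T \<noteq> 0"
      "\<forall>j\<in>{1..N'}. (\<Sum>S | card S = k. (\<Prod>i\<in>S. v j $ i) * c S) = 0"
      using homogeneous_system_nontrivial_solution
        [of "{1..N'}" "{S :: 'n set. card S = k}" "\<lambda>j S. \<Prod>i\<in>S. v j $ i"] by auto
    let ?f = "\<lambda>x :: 'a ^ 'n. \<Sum>S | card S = k. c S * (\<Prod>i\<in>S. x $ i)"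
    have "?f (t *s v j) = 0" if "j \<in> {1..N'}" for t j
    proof -
      \<comment> \<open>By homogeneity, vanishing at \<open>v j\<close> is vanishing on the whole
        line through it.\<close>
      have "?f (t *s v j) = t ^ k * (\<Sum>S | card S = k. (\<Prod>i\<in>S. v j $ i) * c S)"
        unfolding sum_distrib_left by (intro sum.cong) (auto simp: prod.distrib algebra_simps)
      then show ?thesis
        using c(3) that by simp
    qed
    then have "\<forall>j\<in>{1..N'}. affine_linear_on (*s) 0 (cyclic_submodule (*s) (v j)) ?f"
      by (auto intro: affine_linear_on_zero_line)
    moreover have "\<not> affine_linear_on (*s) 0 UNIV ?f"
      \<comment> \<open>The remaining condition \<open>k \<ge> 2\<close> comes from
        \<open>n_ge_3\<close>.\<close>
      by (rule homogeneous_not_affine_linear[where c = c, OF _ c(1,2)]) (use k n_ge_3 in linarith)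
    ultimately show ?thesis
      using affine_linear_on_coordinate_lines_monomial_sum by blast
  qed
  ultimately show ?thesis
    by (intro conjI exI[of _ "\<lambda>j. v (j - 1)"]; blast)
qed

end
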